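(* Let $M=(M_n)_{n\in\mathbb{N}}$ be a discrete-time normal martingale with the chaotic representation property, and let $\Phi,\Psi\in\mathcal{S}^*(M)$. Then $\Phi=\Psi$ if and only if $\widehat{\Phi}=\widehat{\Psi}$, where $\widehat{\cdot}$ denotes the Fock transform.
   Context: $\mathbb{N}$ is the set of nonnegative integers and $\Gamma$ is the (countably infinite) set of all finite subsets of $\mathbb{N}$. $(\Omega,\mathcal{F},P)$ is a probability space; $\langle\cdot,\cdot\rangle$ and $\|\cdot\|$ are the inner product (conjugate-linear in the first argument, linear in the second) and norm of the Hilbert space $\mathcal{L}^2(\Omega,\mathcal{F},P)$ of complex-valued square integrable functions. A real-valued square integrable process $M=(M_n)_{n\in\mathbb{N}}$ on $(\Omega,\mathcal{F},P)$ is a discrete-time normal martingale if, with $\mathcal{F}_{-1}=\{\emptyset,\Omega\}$ and $\mathcal{F}_n=\sigma(M_k;0\le k\le n)$: (i) $\mathbb{E}[M_0|\mathcal{F}_{-1}]=0$ and $\mathbb{E}[M_n|\mathcal{F}_{n-1}]=M_{n-1}$ for $n\ge1$; (ii) $\mathbb{E}[M_0^2|\mathcal{F}_{-1}]=1$ and $\mathbb{E}[M_n^2|\mathcal{F}_{n-1}]=M_{n-1}^2+1$ for $n\ge1$. Put $Z_0=M_0$, $Z_n=M_n-M_{n-1}$ for $n\ge1$, $Z_\emptyset=1$, and $Z_\sigma=\prod_{i\in\sigma}Z_i$ for nonempty $\sigma\in\Gamma$; $\{Z_\sigma\mid\sigma\in\Gamma\}$ is an orthonormal system in $\mathcal{L}^2(\Omega,\mathcal{F},P)$.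 Let $\mathcal{F}_\infty=\sigma(M_n;n\in\mathbb{N})$ and $\mathcal{L}^2(M)=\mathcal{L}^2(\Omega,\mathcal{F}_\infty,P)$. $M$ has the chaotic representation property if $\{Z_\sigma\mid\sigma\in\Gamma\}$ is total in $\mathcal{L}^2(M)$ (hence an orthonormal basis of it). Let $\lambda_\emptyset=1$ and $\lambda_\sigma=\prod_{k\in\sigma}(k+1)$ for nonempty $\sigma\in\Gamma$. For $p\ge0$ put $\|\xi\|_p^2=\sum_{\sigma\in\Gamma}\lambda_\sigma^{2p}|\langle Z_\sigma,\xi\rangle|^2$ for $\xi\in\mathcal{L}^2(M)$, and $\mathcal{S}_p(M)=\{\xi\in\mathcal{L}^2(M)\mid\|\xi\|_p<\infty\}$, a Hilbert space with norm $\|\cdot\|_p$. Let $\mathcal{S}(M)=\bigcap_{p=0}^\infty\mathcal{S}_p(M)$ with the topology generated by the norms $\{\|\cdot\|_p\}_{p\ge0}$; all $Z_\sigma$ belong to $\mathcal{S}(M)$. $\mathcal{S}^*(M)$ is the dual of $\mathcal{S}(M)$ (continuous linear functionals); its elements are called generalized functionals of $M$. The Fock transform of $\Phi\in\mathcal{S}^*(M)$ is the function $\widehat{\Phi}$ on $\Gamma$ given by $\widehat{\Phi}(\sigma)=\Phi(Z_\sigma)$, $\sigma\in\Gamma$. *)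

theory Defs
  imports "HOL-Probability.Probability"
begin

section \<open>Discrete-time normal martingales\<close>

text \<open>
  \<open>gen_sigma P M I\<close> is the sigma-algebra on \<open>space P\<close> generated by the \<open>M k\<close> with \<open>k \<in> I\<close>.
  Thus \<open>I = {}\<close> gives the trivial sigma-algebra \<open>F\<^sub>-\<^sub>1\<close>, \<open>I = {..n}\<close> gives \<open>F\<^sub>n\<close>, and
  \<open>I = UNIV\<close> gives \<open>F\<^sub>\<infinity>\<close>. Only its \<open>space\<close> and \<open>sets\<close> are relevant; measures are always
  taken with respect to \<open>P\<close>.
\<close>

definition gen_sigma :: "'a measure \<Rightarrow> (nat \<Rightarrow> 'a \<Rightarrow> real) \<Rightarrow> nat set \<Rightarrow> 'a measure" where
  "gen_sigma P M I = sigma (space P) {M k -` B \<inter> space P | k B. k \<in> I \<and> B \<in> sets borel}"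

locale normal_martingale = prob_space P for P :: "'a measure" +
  fixes M :: "nat \<Rightarrow> 'a \<Rightarrow> real"
  assumes measurable_process: "\<And>n. M n \<in> borel_measurable P"
    and square_integrable_process: "\<And>n. integrable P (\<lambda>\<omega>. (M n \<omega>)\<^sup>2)"
    and cond_exp_0: "AE \<omega> in P. real_cond_exp P (gen_sigma P M {}) (M 0) \<omega> = 0"
    and cond_exp_Suc:
      "\<And>n. AE \<omega> in P. real_cond_exp P (gen_sigma P M {..n}) (M (Suc n)) \<omega> = M n \<omega>"
    and cond_exp_square_0:
      "AE \<omega> in P. real_cond_exp P (gen_sigma P M {}) (\<lambda>\<omega>. (M 0 \<omega>)\<^sup>2) \<omega> = 1"
    and cond_exp_square_Suc:
      "\<And>n. AE \<omega> in P. real_cond_exp P (gen_sigma P M {..n}) (\<lambda>\<omega>. (M (Suc n) \<omega>)\<^sup>2) \<omega>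
        = (M n \<omega>)\<^sup>2 + 1"

definition Gamma :: "nat set set" where
  "Gamma = {\<sigma>. finite \<sigma>}"

fun increment :: "(nat \<Rightarrow> 'a \<Rightarrow> real) \<Rightarrow> nat \<Rightarrow> 'a \<Rightarrow> real" where
  "increment M 0 = M 0"
| "increment M (Suc n) = (\<lambda>\<omega>. M (Suc n) \<omega> - M n \<omega>)"

definition Z :: "(nat \<Rightarrow> 'a \<Rightarrow> real) \<Rightarrow> nat set \<Rightarrow> 'a \<Rightarrow> complex" where
  "Z M \<sigma> = (\<lambda>\<omega>. complex_of_real (\<Prod>i\<in>\<sigma>. increment M i \<omega>))"


section \<open>Square integrable functions and chaotic representation\<close>

text \<open>
  Elements of \<open>L\<^sup>2\<close> are represented by functions; almost everywhere equal functions represent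
  the same element.
\<close>

definition L2_inner :: "'a measure \<Rightarrow> ('a \<Rightarrow> complex) \<Rightarrow> ('a \<Rightarrow> complex) \<Rightarrow> complex" where
  "L2_inner P \<xi> \<eta> = (\<integral>\<omega>. cnj (\<xi> \<omega>) * \<eta> \<omega> \<partial>P)"

definition L2_norm :: "'a measure \<Rightarrow> ('a \<Rightarrow> complex) \<Rightarrow> real" where
  "L2_norm P \<xi> = sqrt (\<integral>\<omega>. (cmod (\<xi> \<omega>))\<^sup>2 \<partial>P)"

definition L2 :: "'a measure \<Rightarrow> (nat \<Rightarrow> 'a \<Rightarrow> real) \<Rightarrow> ('a \<Rightarrow> complex) set" where
  "L2 P M = {\<xi> \<in> borel_measurable (gen_sigma P M UNIV). integrable P (\<lambda>\<omega>. (cmod (\<xi> \<omega>))\<^sup>2)}"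

text \<open>Totality of \<open>{Z\<^sub>\<sigma>}\<close>: finite complex linear combinations are norm-dense.\<close>

definition chaotic_representation :: "'a measure \<Rightarrow> (nat \<Rightarrow> 'a \<Rightarrow> real) \<Rightarrow> bool" where
  "chaotic_representation P M \<longleftrightarrow>
    (\<forall>\<xi>\<in>L2 P M. \<forall>\<epsilon>>0. \<exists>A c. finite A \<and> A \<subseteq> Gamma \<and>
      L2_norm P (\<lambda>\<omega>. \<xi> \<omega> - (\<Sum>\<sigma>\<in>A. c \<sigma> * Z M \<sigma> \<omega>)) < \<epsilon>)"


section \<open>Testing and generalized functionals\<close>

definition lam :: "nat set \<Rightarrow> real" where
  "lam \<sigma> = (\<Prod>k\<in>\<sigma>. real k + 1)"

definition S_norm :: "'a measure \<Rightarrow> (nat \<Rightarrow> 'a \<Rightarrow> real) \<Rightarrow> nat \<Rightarrow> ('a \<Rightarrow> complex) \<Rightarrow> real" where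
  "S_norm P M p \<xi> =
    sqrt (\<Sum>\<^sub>\<infinity>\<sigma>\<in>Gamma. lam \<sigma> ^ (2 * p) * (cmod (L2_inner P (Z M \<sigma>) \<xi>))\<^sup>2)"

text \<open>
  Finiteness of the norm is expressed by summability, since \<open>infsum\<close> is \<open>0\<close> on
  non-summable families.
\<close>

definition S_p :: "'a measure \<Rightarrow> (nat \<Rightarrow> 'a \<Rightarrow> real) \<Rightarrow> nat \<Rightarrow> ('a \<Rightarrow> complex) set" where
  "S_p P M p = {\<xi> \<in> L2 P M.
    (\<lambda>\<sigma>. lam \<sigma> ^ (2 * p) * (cmod (L2_inner P (Z M \<sigma>) \<xi>))\<^sup>2) summable_on Gamma}"

definition S :: "'a measure \<Rightarrow> (nat \<Rightarrow> 'a \<Rightarrow> real) \<Rightarrow> ('a \<Rightarrow> complex) set" where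
  "S P M = (\<Inter>p. S_p P M p)"

definition S_topology ::
  "'a measure \<Rightarrow> (nat \<Rightarrow> 'a \<Rightarrow> real) \<Rightarrow> ('a \<Rightarrow> complex) topology" where
  "S_topology P M = topology_generated_by
    {{\<eta> \<in> S P M. S_norm P M p (\<lambda>\<omega>. \<eta> \<omega> - \<xi> \<omega>) < r} | \<xi> p r. \<xi> \<in> S P M \<and> 0 < r}"

text \<open>
  The continuous linear functionals on \<open>S(M)\<close>. Compatibility with almost everywhere equality
  says that they are functionals of the classes; extensionality (the value \<open>undefined\<close> off
  the representatives) makes equality of functionals equality as HOL functions.
\<close>

definition S_dual ::
  "'a measure \<Rightarrow> (nat \<Rightarrow> 'a \<Rightarrow> real) \<Rightarrow> (('a \<Rightarrow> complex) \<Rightarrow> complex) set" where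
  "S_dual P M = {\<Phi> \<in> extensional (S P M).
    (\<forall>\<xi>\<in>S P M. \<forall>\<eta>\<in>S P M. (AE \<omega> in P. \<xi> \<omega> = \<eta> \<omega>) \<longrightarrow> \<Phi> \<xi> = \<Phi> \<eta>) \<and>
    (\<forall>\<xi>\<in>S P M. \<forall>\<eta>\<in>S P M. \<Phi> (\<lambda>\<omega>. \<xi> \<omega> + \<eta> \<omega>) = \<Phi> \<xi> + \<Phi> \<eta>) \<and>
    (\<forall>\<xi>\<in>S P M. \<forall>c. \<Phi> (\<lambda>\<omega>. c * \<xi> \<omega>) = c * \<Phi> \<xi>) \<and>
    continuous_map (S_topology P M) euclidean \<Phi>}"

definition fock_transform ::
  "(nat \<Rightarrow> 'a \<Rightarrow> real) \<Rightarrow> (('a \<Rightarrow> complex) \<Rightarrow> complex) \<Rightarrow> nat set \<Rightarrow> complex" where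
  "fock_transform M \<Phi> = (\<lambda>\<sigma>\<in>Gamma. \<Phi> (Z M \<sigma>))"

end

theory Submission
  imports Defs
begin

text \<open>
  A generalized functional is determined by its values on the \<open>Z\<^sub>\<sigma>\<close> because every testing
  functional \<open>\<xi>\<close> is the limit, in the topology of \<open>S(M)\<close>, of its own Fourier sums
  \<open>\<Sum>\<^bsub>\<sigma>\<in>A\<^esub> \<langle>Z\<^sub>\<sigma>, \<xi>\<rangle> Z\<^sub>\<sigma>\<close> along the finite sets \<open>A \<subseteq> \<Gamma>\<close>. Applying a continuous linear \<open>\<Phi>\<close> gives
  \<open>\<Phi>(\<xi>) = \<Sum>\<^sub>\<sigma> \<langle>Z\<^sub>\<sigma>, \<xi>\<rangle> \<Phi>(Z\<^sub>\<sigma>)\<close> (\<open>S_dual_has_sum\<close>), in which only the Fock transform of \<open>\<Phi>\<close>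
  appears; equality of the functionals follows from uniqueness of sums.

  Two things carry this. The first is that the \<open>Z\<^sub>\<sigma>\<close> are orthonormal
  (\<open>integral_chaos_mult\<close>). Conditioned on the past, an increment of \<open>M\<close> has mean \<open>0\<close> and
  second moment \<open>1\<close>. Hence in \<open>E[Z\<^sub>\<sigma> Z\<^sub>\<tau>]\<close> the largest index can be removed: it contributes a factor
  \<open>1\<close> if it lies in both sets, and annihilates the integral if it lies in just one of them.

  The second is the convergence of Fourier sums (\<open>limitin_fourier_sum\<close>). By orthonormality,
  replacing \<open>\<xi>\<close> by its Fourier sum over \<open>A\<close> sets the coefficients outside \<open>A\<close> to zero. Each
  \<open>\<parallel>\<cdot>\<parallel>\<^sub>p\<close> is a weighted \<open>\<ell>\<^sup>2\<close> norm of the coefficients, so its distance from any fixed \<open>\<zeta>\<close> is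
  computed by a summable family that is altered at finitely many indices only, and it converges to
  \<open>\<parallel>\<xi> - \<zeta>\<parallel>\<^sub>p\<close>. Convergence of these distances is convergence in the
  topology generated by the balls.
\<close>

section \<open>Orthonormality of the discrete-time chaos system\<close>

lemma norm_add_square_le:
  fixes a b :: "'b::real_normed_vector"
  shows "(norm (a + b))\<^sup>2 \<le> 2 * (norm a)\<^sup>2 + 2 * (norm b)\<^sup>2"
proof -
  have "(norm (a + b))\<^sup>2 \<le> (norm a + norm b)\<^sup>2"
    by (intro power_mono norm_triangle_ineq) simp
  also have "\<dots> \<le> 2 * (norm a)\<^sup>2 + 2 * (norm b)\<^sup>2"
    using sum_squares_bound[of "norm a" "norm b"] by (simp add: power2_sum)
  finally show ?thesis .
qed

lemma integrable_mult_of_square_integrable: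
  fixes f g :: "'a \<Rightarrow> 'b::{real_normed_algebra, banach, second_countable_topology}"
  assumes [measurable]: "f \<in> borel_measurable N" "g \<in> borel_measurable N"
    and "integrable N (\<lambda>x. (norm (f x))\<^sup>2)" "integrable N (\<lambda>x. (norm (g x))\<^sup>2)"
  shows "integrable N (\<lambda>x. f x * g x)"
proof (rule Bochner_Integration.integrable_bound)
  show "integrable N (\<lambda>x. (norm (f x))\<^sup>2 + (norm (g x))\<^sup>2)"
    using assms by simp
  have "norm (f x * g x) \<le> norm ((norm (f x))\<^sup>2 + (norm (g x))\<^sup>2)" for x
  proof -
    have "norm (f x * g x) \<le> norm (f x) * norm (g x)"
      by (rule norm_mult_ineq)
    also have "\<dots> \<le> (norm (f x))\<^sup>2 + (norm (g x))\<^sup>2"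
      using sum_squares_bound[of "norm (f x)" "norm (g x)"]
        mult_nonneg_nonneg[OF norm_ge_zero[of "f x"] norm_ge_zero[of "g x"]] by linarith
    finally show ?thesis by simp
  qed
  then show "AE x in N. norm (f x * g x) \<le> norm ((norm (f x))\<^sup>2 + (norm (g x))\<^sup>2)"
    by simp
qed measurable

context normal_martingale
begin

lemma space_gen_sigma [simp]: "space (gen_sigma P M I) = space P"
  unfolding gen_sigma_def by (rule space_measure_of) auto

lemma sets_gen_sigma:
  "sets (gen_sigma P M I)
    = sigma_sets (space P) {M k -` B \<inter> space P | k B. k \<in> I \<and> B \<in> sets borel}"
  unfolding gen_sigma_def by (rule sets_measure_of) auto

lemma subalgebra_gen_sigma: "subalgebra P (gen_sigma P M I)"
  unfolding subalgebra_def
proof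
  show "sets (gen_sigma P M I) \<subseteq> sets P"
    unfolding sets_gen_sigma
    by (rule sets.sigma_sets_subset) (auto intro: measurable_sets[OF measurable_process])
qed simp

lemma sigma_finite_gen_sigma: "sigma_finite_subalgebra P (gen_sigma P M I)"
proof -
  interpret finite_measure_subalgebra P "gen_sigma P M I"
    by unfold_locales (rule subalgebra_gen_sigma)
  show ?thesis by unfold_locales
qed

lemma measurable_process_gen_sigma:
  assumes "k \<in> I"
  shows "M k \<in> borel_measurable (gen_sigma P M I)"
proof (rule measurableI)
  fix B :: "real set" assume "B \<in> sets borel"
  then show "M k -` B \<inter> space (gen_sigma P M I) \<in> sets (gen_sigma P M I)"
    using assms unfolding sets_gen_sigma by auto
qed simp

lemma measurable_increment_gen_sigma:
  assumes "k \<in> I" "\<And>j. Suc j = k \<Longrightarrow> j \<in> I"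
  shows "increment M k \<in> borel_measurable (gen_sigma P M I)"
  using assms
  by (cases k) (auto intro!: borel_measurable_diff measurable_process_gen_sigma)

lemma measurable_chaos_gen_sigma:
  assumes "\<sigma> \<subseteq> {..<n}"
  shows "(\<lambda>\<omega>. \<Prod>i\<in>\<sigma>. increment M i \<omega>) \<in> borel_measurable (gen_sigma P M {..<n})"
  using assms
  by (intro borel_measurable_prod measurable_increment_gen_sigma) auto

lemma measurable_increment [measurable]: "increment M k \<in> borel_measurable P"
  using measurable_from_subalg[OF subalgebra_gen_sigma measurable_increment_gen_sigma[of k UNIV]]
  by simp

lemma integrable_process_mult: "integrable P (\<lambda>\<omega>. M j \<omega> * M k \<omega>)"
  by (rule integrable_mult_of_square_integrable)
    (simp_all add: measurable_process square_integrable_process)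

lemma integrable_process: "integrable P (M n)"
  by (rule square_integrable_imp_integrable[OF measurable_process square_integrable_process])

text \<open>
  Writing \<open>{..<n}\<close> for the past makes one statement cover \<open>n = 0\<close>, where the conditioning is on
  the trivial sigma-algebra, and the successor steps.
\<close>

lemma cond_exp_increment:
  "AE \<omega> in P. real_cond_exp P (gen_sigma P M {..<n}) (increment M n) \<omega> = 0"
proof (cases n)
  case 0
  then show ?thesis using cond_exp_0 by simp
next
  case (Suc m)
  interpret F: sigma_finite_subalgebra P "gen_sigma P M {..m}"
    by (rule sigma_finite_gen_sigma)
  have "M m \<in> borel_measurable (gen_sigma P M {..m})"
    by (rule measurable_process_gen_sigma) simp
  note F.real_cond_exp_diff[OF integrable_process integrable_process, of "Suc m" m]
    F.real_cond_exp_F_meas[OF integrable_process this] cond_exp_Suc[of m]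
  then show ?thesis
    unfolding Suc lessThan_Suc_atMost increment.simps by eventually_elim simp
qed

text \<open>
  For \<open>n = m + 1\<close> expand \<open>(M\<^sub>n - M\<^sub>m)\<^sup>2\<close>. As \<open>M\<^sub>m\<close> is known at time \<open>m\<close>, the conditional
  expectation is \<open>(M\<^sub>m\<^sup>2 + 1) + M\<^sub>m\<^sup>2 - 2 M\<^sub>m M\<^sub>m = 1\<close>.
\<close>

lemma cond_exp_square_increment:
  "AE \<omega> in P. real_cond_exp P (gen_sigma P M {..<n}) (\<lambda>\<omega>. (increment M n \<omega>)\<^sup>2) \<omega> = 1"
proof (cases n)
  case 0
  then show ?thesis using cond_exp_square_0 by simp
next
  case (Suc m)
  interpret F: sigma_finite_subalgebra P "gen_sigma P M {..m}"
    by (rule sigma_finite_gen_sigma)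
  have meas [measurable]: "M m \<in> borel_measurable (gen_sigma P M {..m})"
    by (rule measurable_process_gen_sigma) simp
  have expand: "(\<lambda>\<omega>. (increment M n \<omega>)\<^sup>2)
      = (\<lambda>\<omega>. ((M (Suc m) \<omega>)\<^sup>2 + (M m \<omega>)\<^sup>2) - 2 * (M m \<omega> * M (Suc m) \<omega>))"
    by (simp add: Suc fun_eq_iff power2_diff)
  have sq: "integrable P (\<lambda>\<omega>. (M (Suc m) \<omega>)\<^sup>2 + (M m \<omega>)\<^sup>2)"
    by (simp add: square_integrable_process)
  have mixed: "integrable P (\<lambda>\<omega>. 2 * (M m \<omega> * M (Suc m) \<omega>))"
    by (simp add: integrable_process_mult)
  have "(\<lambda>\<omega>. (M m \<omega>)\<^sup>2) \<in> borel_measurable (gen_sigma P M {..m})"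
    by measurable
  note F.real_cond_exp_diff[OF sq mixed]
    F.real_cond_exp_add[OF square_integrable_process square_integrable_process, of "Suc m" m]
    F.real_cond_exp_F_meas[OF square_integrable_process this]
    F.real_cond_exp_cmult[OF integrable_process_mult[of m "Suc m"], of 2]
    F.real_cond_exp_mult[OF meas measurable_process integrable_process_mult[of m "Suc m"]]
    cond_exp_Suc[of m] cond_exp_square_Suc[of m]
  then show ?thesis
    unfolding expand unfolding Suc lessThan_Suc_atMost
    by eventually_elim (simp add: power2_eq_square)
qed

text \<open>
  The square integrability of products of increments is itself a consequence of the conditional
  second moments. It has to be derived from nonnegative integrals, which make sense before any
  product is known to be integrable.
\<close>

lemma nn_integral_mult_square_increment:
  assumes [measurable]: "f \<in> borel_measurable (gen_sigma P M {..<n})"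
  shows "(\<integral>\<^sup>+\<omega>. f \<omega> * ennreal ((increment M n \<omega>)\<^sup>2) \<partial>P) = (\<integral>\<^sup>+\<omega>. f \<omega> \<partial>P)"
proof -
  let ?F = "gen_sigma P M {..<n}"
  let ?g = "\<lambda>\<omega>. ennreal ((increment M n \<omega>)\<^sup>2)"
  interpret F: sigma_finite_subalgebra P ?F
    by (rule sigma_finite_gen_sigma)
  have "AE \<omega> in P. nn_cond_exp P ?F (\<lambda>\<omega>. 0) \<omega> = 0"
    using F.nn_cond_exp_F_meas[of "\<lambda>\<omega>. 0"] by simp
  \<comment> \<open>The real conditional expectation is the difference of those of the positive and the negative
    part. Here the latter vanishes, and \<open>enn2real\<close> takes the value \<open>1\<close> only at \<open>1\<close>, as it sends
    \<open>\<infinity>\<close> to \<open>0\<close>.\<close>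
  with cond_exp_square_increment[of n]
  have *: "AE \<omega> in P. nn_cond_exp P ?F ?g \<omega> = 1"
  proof eventually_elim
    case (elim \<omega>)
    then have "enn2real (nn_cond_exp P ?F ?g \<omega>) = 1"
      by (simp add: real_cond_exp_def ennreal_neg)
    then show ?case
      by (cases "nn_cond_exp P ?F ?g \<omega>" rule: ennreal_cases) auto
  qed
  have "(\<integral>\<^sup>+\<omega>. f \<omega> * ?g \<omega> \<partial>P) = (\<integral>\<^sup>+\<omega>. f \<omega> * nn_cond_exp P ?F ?g \<omega> \<partial>P)"
    by (rule F.nn_cond_exp_intg[symmetric]) measurable
  also have "\<dots> = (\<integral>\<^sup>+\<omega>. f \<omega> \<partial>P)"
    by (rule nn_integral_cong_AE) (use * in \<open>auto elim!: eventually_mono\<close>)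
  finally show ?thesis .
qed

lemma nn_integral_square_chaos:
  assumes "\<sigma> \<subseteq> {..<n}"
  shows "(\<integral>\<^sup>+\<omega>. ennreal ((\<Prod>i\<in>\<sigma>. increment M i \<omega>)\<^sup>2) \<partial>P) = 1"
  using assms
proof (induction n arbitrary: \<sigma>)
  case 0
  then show ?case by (simp add: emeasure_space_1)
next
  case (Suc n)
  show ?case
  proof (cases "n \<in> \<sigma>")
    case False
    with Suc.prems have "\<sigma> \<subseteq> {..<n}" by (force simp: less_Suc_eq)
    then show ?thesis by (rule Suc.IH)
  next
    case True
    define \<tau> where "\<tau> = \<sigma> - {n}"
    have \<tau>: "\<tau> \<subseteq> {..<n}" "n \<notin> \<tau>" "\<sigma> = insert n \<tau>" "finite \<tau>"
      using Suc.prems True finite_subset[OF Suc.prems]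
      by (auto simp: \<tau>_def less_Suc_eq)
    note measurable_chaos_gen_sigma[OF \<tau>(1), measurable]
    have "(\<integral>\<^sup>+\<omega>. ennreal ((\<Prod>i\<in>\<sigma>. increment M i \<omega>)\<^sup>2) \<partial>P)
        = (\<integral>\<^sup>+\<omega>. ennreal ((\<Prod>i\<in>\<tau>. increment M i \<omega>)\<^sup>2) * ennreal ((increment M n \<omega>)\<^sup>2) \<partial>P)"
      using \<tau> by (simp add: power_mult_distrib ennreal_mult mult.commute)
    also have "\<dots> = (\<integral>\<^sup>+\<omega>. ennreal ((\<Prod>i\<in>\<tau>. increment M i \<omega>)\<^sup>2) \<partial>P)"
      by (rule nn_integral_mult_square_increment) measurable
    also have "\<dots> = 1"
      by (rule Suc.IH[OF \<tau>(1)])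
    finally show ?thesis .
  qed
qed

lemma integrable_square_chaos:
  assumes "finite \<sigma>"
  shows "integrable P (\<lambda>\<omega>. (\<Prod>i\<in>\<sigma>. increment M i \<omega>)\<^sup>2)"
proof -
  obtain n where "\<sigma> \<subseteq> {..<n}"
    using assms finite_nat_iff_bounded by blast
  from nn_integral_square_chaos[OF this] show ?thesis
    by (intro integrableI_bounded) auto
qed

lemma integrable_chaos_mult:
  assumes "finite \<sigma>" "finite \<tau>"
  shows "integrable P (\<lambda>\<omega>. (\<Prod>i\<in>\<sigma>. increment M i \<omega>) * (\<Prod>i\<in>\<tau>. increment M i \<omega>))"
  by (rule integrable_mult_of_square_integrable) (use assms integrable_square_chaos in auto)

lemma integral_mult_increment:
  assumes "f \<in> borel_measurable (gen_sigma P M {..<n})"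
    and "integrable P (\<lambda>\<omega>. f \<omega> * increment M n \<omega>)"
  shows "(\<integral>\<omega>. f \<omega> * increment M n \<omega> \<partial>P) = 0"
proof -
  interpret F: sigma_finite_subalgebra P "gen_sigma P M {..<n}"
    by (rule sigma_finite_gen_sigma)
  have "(\<integral>\<omega>. f \<omega> * increment M n \<omega> \<partial>P)
      = (\<integral>\<omega>. f \<omega> * real_cond_exp P (gen_sigma P M {..<n}) (increment M n) \<omega> \<partial>P)"
    by (rule F.real_cond_exp_intg(2)[symmetric]) (use assms in auto)
  also have "\<dots> = (\<integral>\<omega>. 0 \<partial>P)"
    by (rule integral_cong_AE)
      (use cond_exp_increment[of n] measurable_from_subalg[OF subalgebra_gen_sigma assms(1)]
        in \<open>auto elim!: eventually_mono\<close>)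
  finally show ?thesis by simp
qed

lemma integral_mult_square_increment:
  assumes "f \<in> borel_measurable (gen_sigma P M {..<n})"
    and "integrable P (\<lambda>\<omega>. f \<omega> * (increment M n \<omega>)\<^sup>2)"
  shows "(\<integral>\<omega>. f \<omega> * (increment M n \<omega>)\<^sup>2 \<partial>P) = (\<integral>\<omega>. f \<omega> \<partial>P)"
proof -
  interpret F: sigma_finite_subalgebra P "gen_sigma P M {..<n}"
    by (rule sigma_finite_gen_sigma)
  have "(\<integral>\<omega>. f \<omega> * (increment M n \<omega>)\<^sup>2 \<partial>P)
      = (\<integral>\<omega>. f \<omega> * real_cond_exp P (gen_sigma P M {..<n}) (\<lambda>\<omega>. (increment M n \<omega>)\<^sup>2) \<omega> \<partial>P)"
    by (rule F.real_cond_exp_intg(2)[symmetric]) (use assms in auto)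
  also have "\<dots> = (\<integral>\<omega>. f \<omega> \<partial>P)"
    by (rule integral_cong_AE)
      (use cond_exp_square_increment[of n] measurable_from_subalg[OF subalgebra_gen_sigma assms(1)]
        in \<open>auto elim!: eventually_mono\<close>)
  finally show ?thesis .
qed

text \<open>
  Induction on a bound for the indices. Let \<open>\<sigma>'\<close>, \<open>\<tau>'\<close> arise from \<open>\<sigma>\<close>, \<open>\<tau>\<close> by removing the largest
  admissible index \<open>n\<close>; the product over \<open>\<sigma>'\<close> and \<open>\<tau>'\<close> is known before time \<open>n\<close>. It remains to
  see whether the increment at \<open>n\<close> occurs to the power \<open>0\<close>, \<open>1\<close> or \<open>2\<close>.
\<close>

lemma integral_chaos_mult_less:
  assumes "\<sigma> \<subseteq> {..<n}" "\<tau> \<subseteq> {..<n}"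
  shows "(\<integral>\<omega>. (\<Prod>i\<in>\<sigma>. increment M i \<omega>) * (\<Prod>i\<in>\<tau>. increment M i \<omega>) \<partial>P)
    = (if \<sigma> = \<tau> then 1 else 0)"
  using assms
proof (induction n arbitrary: \<sigma> \<tau>)
  case 0
  then show ?case by (simp add: prob_space)
next
  case (Suc n)
  define \<sigma>' \<tau>' where "\<sigma>' = \<sigma> - {n}" and "\<tau>' = \<tau> - {n}"
  have fin: "finite \<sigma>" "finite \<tau>" "finite \<sigma>'" "finite \<tau>'"
    using finite_subset[OF Suc.prems(1)] finite_subset[OF Suc.prems(2)]
    by (auto simp: \<sigma>'_def \<tau>'_def)
  have sub: "\<sigma>' \<subseteq> {..<n}" "\<tau>' \<subseteq> {..<n}"
    using Suc.prems by (auto simp: \<sigma>'_def \<tau>'_def less_Suc_eq)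
  have notin: "n \<notin> \<sigma>'" "n \<notin> \<tau>'" by (auto simp: \<sigma>'_def \<tau>'_def)
  let ?z = "increment M n"
  let ?f = "\<lambda>\<omega>. (\<Prod>i\<in>\<sigma>'. increment M i \<omega>) * (\<Prod>i\<in>\<tau>'. increment M i \<omega>)"
  have meas: "?f \<in> borel_measurable (gen_sigma P M {..<n})"
    by (intro borel_measurable_times measurable_chaos_gen_sigma sub)
  note int = integrable_chaos_mult[OF fin(1,2)]
  have one: "(\<integral>\<omega>. ?f \<omega> * ?z \<omega> \<partial>P) = 0" if "integrable P (\<lambda>\<omega>. ?f \<omega> * ?z \<omega>)"
    by (rule integral_mult_increment[OF meas that])
  consider "n \<notin> \<sigma>" "n \<notin> \<tau>" | "n \<in> \<sigma>" "n \<notin> \<tau>" | "n \<notin> \<sigma>" "n \<in> \<tau>" | "n \<in> \<sigma>" "n \<in> \<tau>"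
    by blast
  then show ?case
  proof cases
    case 1
    then have "\<sigma> = \<sigma>'" "\<tau> = \<tau>'" by (auto simp: \<sigma>'_def \<tau>'_def)
    then show ?thesis using Suc.IH[OF sub] by simp
  next
    case 2
    then have eq: "\<sigma> = insert n \<sigma>'" "\<tau> = \<tau>'" by (auto simp: \<sigma>'_def \<tau>'_def)
    then show ?thesis using 2 one int fin notin
      by (auto simp: mult_ac)
  next
    case 3
    then have eq: "\<sigma> = \<sigma>'" "\<tau> = insert n \<tau>'" by (auto simp: \<sigma>'_def \<tau>'_def)
    then show ?thesis using 3 one int fin notin
      by (auto simp: mult_ac)
  next
    case 4
    then have eq: "\<sigma> = insert n \<sigma>'" "\<tau> = insert n \<tau>'" by (auto simp: \<sigma>'_def \<tau>'_def)
    have prod: "(\<lambda>\<omega>. (\<Prod>i\<in>\<sigma>. increment M i \<omega>) * (\<Prod>i\<in>\<tau>. increment M i \<omega>))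
        = (\<lambda>\<omega>. ?f \<omega> * (?z \<omega>)\<^sup>2)"
      using fin notin by (simp add: eq power2_eq_square mult_ac)
    have "\<sigma> = \<tau> \<longleftrightarrow> \<sigma>' = \<tau>'" using notin by (auto simp: eq)
    then show ?thesis
      using integral_mult_square_increment[OF meas] int Suc.IH[OF sub]
      unfolding prod by simp
  qed
qed

lemma integral_chaos_mult:
  assumes "finite \<sigma>" "finite \<tau>"
  shows "(\<integral>\<omega>. (\<Prod>i\<in>\<sigma>. increment M i \<omega>) * (\<Prod>i\<in>\<tau>. increment M i \<omega>) \<partial>P)
    = (if \<sigma> = \<tau> then 1 else 0)"
proof -
  obtain n where "\<sigma> \<union> \<tau> \<subseteq> {..<n}"
    using assms finite_nat_iff_bounded[of "\<sigma> \<union> \<tau>"] by blast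
  then show ?thesis by (intro integral_chaos_mult_less[of _ n]) auto
qed

section \<open>Fourier coefficients and testing functionals\<close>

lemma L2_inner_Z:
  assumes "\<sigma> \<in> Gamma" "\<tau> \<in> Gamma"
  shows "L2_inner P (Z M \<sigma>) (Z M \<tau>) = (if \<sigma> = \<tau> then 1 else 0)"
proof -
  have "L2_inner P (Z M \<sigma>) (Z M \<tau>)
      = complex_of_real (\<integral>\<omega>. (\<Prod>i\<in>\<sigma>. increment M i \<omega>) * (\<Prod>i\<in>\<tau>. increment M i \<omega>) \<partial>P)"
    unfolding L2_inner_def Z_def
    by (subst integral_complex_of_real[symmetric]) (simp del: of_real_prod)
  then show ?thesis
    using assms by (simp add: integral_chaos_mult Gamma_def)
qed

lemma Z_in_L2:
  assumes "\<sigma> \<in> Gamma"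
  shows "Z M \<sigma> \<in> L2 P M"
  unfolding L2_def
proof (intro CollectI conjI)
  show "Z M \<sigma> \<in> borel_measurable (gen_sigma P M UNIV)"
    unfolding Z_def
    by (intro measurable_compose[OF _ borel_measurable_of_real]
        borel_measurable_prod measurable_increment_gen_sigma) auto
  show "integrable P (\<lambda>\<omega>. (cmod (Z M \<sigma> \<omega>))\<^sup>2)"
    using assms integrable_square_chaos[of \<sigma>]
    by (simp add: Z_def Gamma_def del: of_real_prod)
qed

lemma L2_measurable:
  assumes "\<xi> \<in> L2 P M"
  shows "\<xi> \<in> borel_measurable P"
  using assms measurable_from_subalg[OF subalgebra_gen_sigma] by (auto simp: L2_def)

lemma L2_integrable_inner:
  assumes "\<xi> \<in> L2 P M" "\<eta> \<in> L2 P M"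
  shows "integrable P (\<lambda>\<omega>. cnj (\<xi> \<omega>) * \<eta> \<omega>)"
proof (rule integrable_mult_of_square_integrable)
  have "cnj \<in> borel_measurable borel"
    by (intro borel_measurable_continuous_onI continuous_intros)
  from measurable_compose[OF L2_measurable[OF assms(1)] this]
  show "(\<lambda>\<omega>. cnj (\<xi> \<omega>)) \<in> borel_measurable P" .
  show "\<eta> \<in> borel_measurable P"
    by (rule L2_measurable[OF assms(2)])
qed (use assms in \<open>simp_all add: L2_def\<close>)

lemma L2_add:
  assumes "\<xi> \<in> L2 P M" "\<eta> \<in> L2 P M"
  shows "(\<lambda>\<omega>. \<xi> \<omega> + \<eta> \<omega>) \<in> L2 P M"
  unfolding L2_def
proof (intro CollectI conjI)
  show "(\<lambda>\<omega>. \<xi> \<omega> + \<eta> \<omega>) \<in> borel_measurable (gen_sigma P M UNIV)"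
    using assms by (auto simp: L2_def)
  note [measurable] = L2_measurable[OF assms(1)] L2_measurable[OF assms(2)]
  show "integrable P (\<lambda>\<omega>. (cmod (\<xi> \<omega> + \<eta> \<omega>))\<^sup>2)"
  proof (rule Bochner_Integration.integrable_bound)
    show "integrable P (\<lambda>\<omega>. 2 * (cmod (\<xi> \<omega>))\<^sup>2 + 2 * (cmod (\<eta> \<omega>))\<^sup>2)"
      using assms by (simp add: L2_def)
    show "AE \<omega> in P. norm ((cmod (\<xi> \<omega> + \<eta> \<omega>))\<^sup>2)
        \<le> norm (2 * (cmod (\<xi> \<omega>))\<^sup>2 + 2 * (cmod (\<eta> \<omega>))\<^sup>2)"
      by (simp add: norm_add_square_le)
  qed measurable
qed

lemma L2_scale:
  assumes "\<xi> \<in> L2 P M"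
  shows "(\<lambda>\<omega>. c * \<xi> \<omega>) \<in> L2 P M"
  using assms by (auto simp: L2_def norm_mult power_mult_distrib)

lemma L2_sum:
  assumes "finite A" "A \<subseteq> Gamma"
  shows "(\<lambda>\<omega>. \<Sum>\<tau>\<in>A. c \<tau> * Z M \<tau> \<omega>) \<in> L2 P M"
  using assms
proof (induction A rule: finite_induct)
  case empty
  then show ?case by (simp add: L2_def)
next
  case (insert \<sigma> A)
  then show ?case
    using L2_add[OF L2_scale[OF Z_in_L2, of \<sigma> "c \<sigma>"], of "\<lambda>\<omega>. \<Sum>\<tau>\<in>A. c \<tau> * Z M \<tau> \<omega>"] by simp
qed

text \<open>Orthonormality reads off the coefficients of a finite combination.\<close>

lemma L2_inner_sum_Z:
  assumes "finite A" "A \<subseteq> Gamma" "\<sigma> \<in> Gamma"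
  shows "L2_inner P (Z M \<sigma>) (\<lambda>\<omega>. \<Sum>\<tau>\<in>A. c \<tau> * Z M \<tau> \<omega>) = (if \<sigma> \<in> A then c \<sigma> else 0)"
proof -
  have "L2_inner P (Z M \<sigma>) (\<lambda>\<omega>. \<Sum>\<tau>\<in>A. c \<tau> * Z M \<tau> \<omega>)
      = (\<integral>\<omega>. (\<Sum>\<tau>\<in>A. c \<tau> * (cnj (Z M \<sigma> \<omega>) * Z M \<tau> \<omega>)) \<partial>P)"
    unfolding L2_inner_def by (simp add: sum_distrib_left mult.left_commute)
  also have "\<dots> = (\<Sum>\<tau>\<in>A. c \<tau> * L2_inner P (Z M \<sigma>) (Z M \<tau>))"
  proof -
    have "integrable P (\<lambda>\<omega>. c \<tau> * (cnj (Z M \<sigma> \<omega>) * Z M \<tau> \<omega>))" if "\<tau> \<in> A" for \<tau>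
    proof -
      have "\<tau> \<in> Gamma" using assms(2) that by blast
      then show ?thesis
        by (rule integrable_mult_right[OF L2_integrable_inner[OF Z_in_L2[OF assms(3)] Z_in_L2]])
    qed
    from Bochner_Integration.integral_sum[OF this] show ?thesis
      by (simp add: L2_inner_def)
  qed
  also have "\<dots> = (\<Sum>\<tau>\<in>A. if \<sigma> = \<tau> then c \<tau> else 0)"
    by (rule sum.cong[OF refl]) (use assms in \<open>simp add: L2_inner_Z subset_iff\<close>)
  finally show ?thesis using assms by simp
qed

lemma L2_inner_diff:
  assumes "\<zeta> \<in> L2 P M" "\<xi> \<in> L2 P M" "\<eta> \<in> L2 P M"
  shows "L2_inner P \<zeta> (\<lambda>\<omega>. \<xi> \<omega> - \<eta> \<omega>) = L2_inner P \<zeta> \<xi> - L2_inner P \<zeta> \<eta>"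
  using Bochner_Integration.integral_diff
    [OF L2_integrable_inner[OF assms(1,2)] L2_integrable_inner[OF assms(1,3)]]
  by (simp add: L2_inner_def right_diff_distrib)

text \<open>
  A finite combination has finitely many nonzero coefficients, so all its weighted norms are finite,
  however fast the weights grow.
\<close>

lemma sum_Z_in_S:
  assumes "finite A" "A \<subseteq> Gamma"
  shows "(\<lambda>\<omega>. \<Sum>\<tau>\<in>A. c \<tau> * Z M \<tau> \<omega>) \<in> S P M"
proof -
  have "(\<lambda>\<sigma>. lam \<sigma> ^ (2 * p) *
      (cmod (L2_inner P (Z M \<sigma>) (\<lambda>\<omega>. \<Sum>\<tau>\<in>A. c \<tau> * Z M \<tau> \<omega>)))\<^sup>2) summable_on Gamma" for p
    by (rule has_sum_imp_summable, rule has_sum_finite_neutralI[OF assms _ refl])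
      (use assms in \<open>simp add: L2_inner_sum_Z\<close>)
  then show ?thesis
    using L2_sum[OF assms] by (simp add: S_def S_p_def)
qed

lemma Z_in_S: "\<sigma> \<in> Gamma \<Longrightarrow> Z M \<sigma> \<in> S P M"
  using sum_Z_in_S[of "{\<sigma>}" "\<lambda>_. 1"] by simp

lemma S_in_L2: "\<xi> \<in> S P M \<Longrightarrow> \<xi> \<in> L2 P M"
  by (auto simp: S_def S_p_def)

section \<open>Convergence of Fourier expansions of testing functionals\<close>

definition fourier_sum :: "('a \<Rightarrow> complex) \<Rightarrow> nat set set \<Rightarrow> 'a \<Rightarrow> complex" where
  "fourier_sum \<xi> A = (\<lambda>\<omega>. \<Sum>\<tau>\<in>A. L2_inner P (Z M \<tau>) \<xi> * Z M \<tau> \<omega>)"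

text \<open>
  With \<open>a\<close>, \<open>b\<close> the coefficients of \<open>\<xi>\<close>, \<open>\<zeta>\<close> and \<open>w\<close> the weights, the squared norm of the difference is
  \<open>\<Sum>\<^bsub>\<sigma>\<in>A\<^esub> w |a - b|\<^sup>2 + \<Sum>\<^bsub>\<sigma>\<notin>A\<^esub> w |b|\<^sup>2\<close>. Both families are summable, so as \<open>A\<close> exhausts \<open>\<Gamma>\<close> the first
  part tends to \<open>\<parallel>\<xi> - \<zeta>\<parallel>\<^sub>p\<^sup>2\<close> and the second to \<open>0\<close>. Allowing an arbitrary center \<open>\<zeta>\<close> matches the balls
  that generate the topology, which need not be centered at \<open>\<xi>\<close>.
\<close>

lemma S_norm_fourier_sum_diff_tendsto:
  assumes "\<xi> \<in> S P M" "\<zeta> \<in> S P M"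
  shows "((\<lambda>A. S_norm P M p (\<lambda>\<omega>. fourier_sum \<xi> A \<omega> - \<zeta> \<omega>))
    \<longlongrightarrow> S_norm P M p (\<lambda>\<omega>. \<xi> \<omega> - \<zeta> \<omega>)) (finite_subsets_at_top Gamma)"
proof -
  define a b where "a = (\<lambda>\<sigma>. L2_inner P (Z M \<sigma>) \<xi>)" and "b = (\<lambda>\<sigma>. L2_inner P (Z M \<sigma>) \<zeta>)"
  define w where "w = (\<lambda>\<sigma>. lam \<sigma> ^ (2 * p))"
  define G where "G = (\<lambda>\<sigma>. w \<sigma> * (cmod (a \<sigma> - b \<sigma>))\<^sup>2)"
  define B where "B = (\<lambda>\<sigma>. w \<sigma> * (cmod (b \<sigma>))\<^sup>2)"
  have w: "w \<sigma> \<ge> 0" for \<sigma> by (simp add: w_def)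
  have sa: "(\<lambda>\<sigma>. w \<sigma> * (cmod (a \<sigma>))\<^sup>2) summable_on Gamma" and sB: "B summable_on Gamma"
    using assms by (auto simp: S_def S_p_def w_def a_def b_def B_def)
  have bound: "G \<sigma> \<le> 2 * (w \<sigma> * (cmod (a \<sigma>))\<^sup>2) + 2 * B \<sigma>" for \<sigma>
  proof -
    have "(cmod (a \<sigma> - b \<sigma>))\<^sup>2 \<le> 2 * (cmod (a \<sigma>))\<^sup>2 + 2 * (cmod (b \<sigma>))\<^sup>2"
      using norm_add_square_le[of "a \<sigma>" "- b \<sigma>"] by simp
    then have "G \<sigma> \<le> w \<sigma> * (2 * (cmod (a \<sigma>))\<^sup>2 + 2 * (cmod (b \<sigma>))\<^sup>2)"
      unfolding G_def by (rule mult_left_mono[OF _ w])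
    then show ?thesis
      by (simp add: B_def algebra_simps)
  qed
  have sG: "G summable_on Gamma"
    by (rule summable_on_comparison_test[where f = "\<lambda>\<sigma>. 2 * (w \<sigma> * (cmod (a \<sigma>))\<^sup>2) + 2 * B \<sigma>"])
      (use bound w in \<open>simp_all add: G_def summable_on_add summable_on_cmult_right sa sB\<close>)
  \<comment> \<open>Writing the norm as the root of the full sum of \<open>B\<close> plus a finite correction on \<open>A\<close> turns the limit
    over \<open>A\<close> into the defining limit of a single sum.\<close>
  have partial: "S_norm P M p (\<lambda>\<omega>. fourier_sum \<xi> A \<omega> - \<zeta> \<omega>)
      = sqrt (infsum B Gamma + (\<Sum>\<sigma>\<in>A. G \<sigma> - B \<sigma>))" if A: "finite A" "A \<subseteq> Gamma" for A
  proof -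
    have coeff: "L2_inner P (Z M \<sigma>) (\<lambda>\<omega>. fourier_sum \<xi> A \<omega> - \<zeta> \<omega>)
        = (if \<sigma> \<in> A then a \<sigma> else 0) - b \<sigma>" if "\<sigma> \<in> Gamma" for \<sigma>
      using L2_inner_diff[OF Z_in_L2 L2_sum S_in_L2] that A assms(2)
      by (simp add: fourier_sum_def L2_inner_sum_Z a_def b_def)
    have "((\<lambda>\<sigma>. if \<sigma> \<in> A then G \<sigma> - B \<sigma> else 0) has_sum (\<Sum>\<sigma>\<in>A. G \<sigma> - B \<sigma>)) Gamma"
      by (rule has_sum_finite_neutralI[OF A]) auto
    from has_sum_add[OF has_sum_infsum[OF sB] this]
    have "((\<lambda>\<sigma>. w \<sigma> * (cmod (L2_inner P (Z M \<sigma>) (\<lambda>\<omega>. fourier_sum \<xi> A \<omega> - \<zeta> \<omega>)))\<^sup>2)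
        has_sum infsum B Gamma + (\<Sum>\<sigma>\<in>A. G \<sigma> - B \<sigma>)) Gamma"
      by (rule has_sum_cong[THEN iffD1, rotated]) (simp add: coeff G_def B_def)
    then show ?thesis
      by (simp add: S_norm_def w_def infsumI)
  qed
  have "((\<lambda>\<sigma>. G \<sigma> - B \<sigma>) has_sum infsum G Gamma - infsum B Gamma) Gamma"
    using has_sum_add[OF has_sum_infsum[OF sG] has_sum_uminusI[OF has_sum_infsum[OF sB]]]
    by simp
  then have "(sum (\<lambda>\<sigma>. G \<sigma> - B \<sigma>) \<longlongrightarrow> infsum G Gamma - infsum B Gamma)
      (finite_subsets_at_top Gamma)"
    by (simp add: has_sum_def)
  then have "((\<lambda>A. sqrt (infsum B Gamma + (\<Sum>\<sigma>\<in>A. G \<sigma> - B \<sigma>)))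
      \<longlongrightarrow> sqrt (infsum B Gamma + (infsum G Gamma - infsum B Gamma)))
      (finite_subsets_at_top Gamma)"
    by (intro tendsto_intros)
  also have "infsum B Gamma + (infsum G Gamma - infsum B Gamma) = infsum G Gamma"
    by simp
  also have "infsum G Gamma
      = (\<Sum>\<^sub>\<infinity>\<sigma>\<in>Gamma. lam \<sigma> ^ (2 * p) * (cmod (L2_inner P (Z M \<sigma>) (\<lambda>\<omega>. \<xi> \<omega> - \<zeta> \<omega>)))\<^sup>2)"
    by (rule infsum_cong)
      (simp add: G_def a_def b_def w_def L2_inner_diff Z_in_L2 S_in_L2 assms)
  finally have "((\<lambda>A. sqrt (infsum B Gamma + (\<Sum>\<sigma>\<in>A. G \<sigma> - B \<sigma>)))
      \<longlongrightarrow> S_norm P M p (\<lambda>\<omega>. \<xi> \<omega> - \<zeta> \<omega>)) (finite_subsets_at_top Gamma)"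
    unfolding S_norm_def .
  moreover have "\<forall>\<^sub>F A in finite_subsets_at_top Gamma.
      sqrt (infsum B Gamma + (\<Sum>\<sigma>\<in>A. G \<sigma> - B \<sigma>))
        = S_norm P M p (\<lambda>\<omega>. fourier_sum \<xi> A \<omega> - \<zeta> \<omega>)"
    by (rule eventually_finite_subsets_at_top_weakI) (rule partial[symmetric])
  ultimately show ?thesis
    by (rule Lim_transform_eventually)
qed

lemma S_norm_diff_self: "S_norm P M p (\<lambda>\<omega>. \<xi> \<omega> - \<xi> \<omega>) = 0"
  by (simp add: S_norm_def L2_inner_def)

text \<open>
  Induction over the generation of the open sets from balls reduces this to the balls, where it is
  the convergence of the norms of the differences.
\<close>

lemma limitin_fourier_sum:
  assumes "\<xi> \<in> S P M"
  shows "limitin (S_topology P M) (fourier_sum \<xi>) \<xi> (finite_subsets_at_top Gamma)"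
  unfolding limitin_def
proof (intro conjI allI impI)
  have "\<xi> \<in> {\<eta> \<in> S P M. S_norm P M 0 (\<lambda>\<omega>. \<eta> \<omega> - \<xi> \<omega>) < 1}"
    using assms S_norm_diff_self[of 0 \<xi>] by simp
  then show "\<xi> \<in> topspace (S_topology P M)"
    unfolding S_topology_def topology_generated_by_topspace
    using assms zero_less_one by blast
next
  fix U assume "openin (S_topology P M) U \<and> \<xi> \<in> U"
  then have "generate_topology_on
      {{\<eta> \<in> S P M. S_norm P M p (\<lambda>\<omega>. \<eta> \<omega> - \<zeta> \<omega>) < r} | \<zeta> p r. \<zeta> \<in> S P M \<and> 0 < r} U"
    and "\<xi> \<in> U"
    by (auto simp: S_topology_def openin_topology_generated_by_iff)
  then show "\<forall>\<^sub>F A in finite_subsets_at_top Gamma. fourier_sum \<xi> A \<in> U"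
  proof induction
    case Empty
    then show ?case by simp
  next
    case (Int U V)
    then show ?case by (auto intro: eventually_conj)
  next
    case (UN K)
    then obtain U where "U \<in> K" "\<xi> \<in> U" by blast
    then have "\<forall>\<^sub>F A in finite_subsets_at_top Gamma. fourier_sum \<xi> A \<in> U"
      by (rule UN.IH)
    then show ?case
      by (rule eventually_mono) (use \<open>U \<in> K\<close> in blast)
  next
    case (Basis U)
    then obtain \<zeta> p r where U: "U = {\<eta> \<in> S P M. S_norm P M p (\<lambda>\<omega>. \<eta> \<omega> - \<zeta> \<omega>) < r}"
      and \<zeta>: "\<zeta> \<in> S P M" by blast
    have "S_norm P M p (\<lambda>\<omega>. \<xi> \<omega> - \<zeta> \<omega>) < r" using Basis U by simp
    then have "\<forall>\<^sub>F A in finite_subsets_at_top Gamma.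
        S_norm P M p (\<lambda>\<omega>. fourier_sum \<xi> A \<omega> - \<zeta> \<omega>) < r"
      by (rule order_tendstoD(2)[OF S_norm_fourier_sum_diff_tendsto[OF assms \<zeta>]])
    moreover have "\<forall>\<^sub>F A in finite_subsets_at_top Gamma. fourier_sum \<xi> A \<in> S P M"
      by (rule eventually_finite_subsets_at_top_weakI) (simp add: fourier_sum_def sum_Z_in_S)
    ultimately show ?case
      unfolding U by eventually_elim simp
  qed
qed

section \<open>Continuous linear functionals\<close>

lemma S_dual_sum_Z:
  assumes \<Phi>: "\<Phi> \<in> S_dual P M" and "finite A" "A \<subseteq> Gamma"
  shows "\<Phi> (\<lambda>\<omega>. \<Sum>\<tau>\<in>A. c \<tau> * Z M \<tau> \<omega>) = (\<Sum>\<tau>\<in>A. c \<tau> * \<Phi> (Z M \<tau>))"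
proof -
  have add: "\<Phi> (\<lambda>\<omega>. \<xi> \<omega> + \<eta> \<omega>) = \<Phi> \<xi> + \<Phi> \<eta>" if "\<xi> \<in> S P M" "\<eta> \<in> S P M" for \<xi> \<eta>
    using \<Phi> that unfolding S_dual_def by blast
  have hom: "\<Phi> (\<lambda>\<omega>. k * \<xi> \<omega>) = k * \<Phi> \<xi>" if "\<xi> \<in> S P M" for \<xi> k
    using \<Phi> that unfolding S_dual_def by blast
  show ?thesis
    using assms(2,3)
  proof (induction A rule: finite_induct)
    case empty
    from hom[OF sum_Z_in_S[of "{}" c], of 0] show ?case by simp
  next
    case (insert \<sigma> A)
    have "\<Phi> (\<lambda>\<omega>. c \<sigma> * Z M \<sigma> \<omega> + (\<Sum>\<tau>\<in>A. c \<tau> * Z M \<tau> \<omega>))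
        = \<Phi> (\<lambda>\<omega>. c \<sigma> * Z M \<sigma> \<omega>) + \<Phi> (\<lambda>\<omega>. \<Sum>\<tau>\<in>A. c \<tau> * Z M \<tau> \<omega>)"
      using insert sum_Z_in_S[of "{\<sigma>}" c] by (intro add sum_Z_in_S) auto
    then show ?case using insert hom[OF Z_in_S] by simp
  qed
qed

text \<open>
  Linearity evaluates the functional on the Fourier sums of \<open>\<xi>\<close>, and continuity passes to the limit.
  In this expansion the functional enters on the left only through its Fock transform.
\<close>

lemma S_dual_has_sum:
  assumes \<Phi>: "\<Phi> \<in> S_dual P M" and \<xi>: "\<xi> \<in> S P M"
  shows "((\<lambda>\<sigma>. L2_inner P (Z M \<sigma>) \<xi> * \<Phi> (Z M \<sigma>)) has_sum \<Phi> \<xi>) Gamma"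
proof -
  have "continuous_map (S_topology P M) euclidean \<Phi>"
    using \<Phi> unfolding S_dual_def by blast
  from continuous_map_limit[OF this limitin_fourier_sum[OF \<xi>]]
  have "((\<lambda>A. \<Phi> (fourier_sum \<xi> A)) \<longlongrightarrow> \<Phi> \<xi>) (finite_subsets_at_top Gamma)"
    by (simp add: o_def)
  moreover have "\<forall>\<^sub>F A in finite_subsets_at_top Gamma.
      \<Phi> (fourier_sum \<xi> A) = sum (\<lambda>\<sigma>. L2_inner P (Z M \<sigma>) \<xi> * \<Phi> (Z M \<sigma>)) A"
    by (rule eventually_finite_subsets_at_top_weakI)
      (simp add: fourier_sum_def S_dual_sum_Z[OF \<Phi>])
  ultimately show ?thesis
    unfolding has_sum_def by (rule Lim_transform_eventually)
qed

end

theorem theorem4p1: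
  fixes P :: "'a measure" and M :: "nat \<Rightarrow> 'a \<Rightarrow> real"
    and \<Phi> \<Psi> :: "('a \<Rightarrow> complex) \<Rightarrow> complex"
  assumes "normal_martingale P M"
    and "chaotic_representation P M"
    and "\<Phi> \<in> S_dual P M"
    and "\<Psi> \<in> S_dual P M"
  shows "\<Phi> = \<Psi> \<longleftrightarrow> fock_transform M \<Phi> = fock_transform M \<Psi>"
proof
  assume eq: "fock_transform M \<Phi> = fock_transform M \<Psi>"
  interpret normal_martingale P M by (rule assms(1))
  have Z: "\<Phi> (Z M \<sigma>) = \<Psi> (Z M \<sigma>)" if "\<sigma> \<in> Gamma" for \<sigma>
    using fun_cong[OF eq, of \<sigma>] that by (simp add: fock_transform_def)
  show "\<Phi> = \<Psi>"
  proof (rule extensionalityI)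
    show "\<Phi> \<in> extensional (S P M)" "\<Psi> \<in> extensional (S P M)"
      using assms(3,4) unfolding S_dual_def by blast+
  next
    fix \<xi> assume \<xi>: "\<xi> \<in> S P M"
    \<comment> \<open>The expansions of \<open>\<Phi> \<xi>\<close> and \<open>\<Psi> \<xi>\<close> are sums of the same family.\<close>
    have "((\<lambda>\<sigma>. L2_inner P (Z M \<sigma>) \<xi> * \<Phi> (Z M \<sigma>)) has_sum \<Psi> \<xi>) Gamma"
      using S_dual_has_sum[OF assms(4) \<xi>] by (rule has_sum_cong[THEN iffD2, rotated]) (simp add: Z)
    then show "\<Phi> \<xi> = \<Psi> \<xi>"
      by (rule has_sum_unique[OF S_dual_has_sum[OF assms(3) \<xi>]])
  qed
qed simp

end
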